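(* Let $G=(V,E)$ be a finite simple graph with $V\neq\emptyset$ and let $\mathcal{C}\subseteq V$ be an independent set of $G$. Then: 1. $\mathbf{M}(G,\mathcal{C})$ is the convex hull of $\{ e_{\mathcal{C}}^{W} : \emptyset\neq W\subseteq V\setminus\mathcal{C}\} \cup \{\delta_{x} : x\in\mathcal{C}\}$. 2. For any $x\in\mathcal{C}$, the distribution $\delta_{x}$ is a vertex of $\mathbf{M}(G,\mathcal{C})$. 3. For any non-empty $W\subseteq V\setminus\mathcal{C}$, the distribution $e_{\mathcal{C}}^{W}$ is a vertex of $\mathbf{M}(G,\mathcal{C})$ if and only if for any $x,y\in W$ with $x\neq y$ there is a path $x=x_{0}\sim x_{1}\sim\dots\sim x_{r}=y$ in $G$ with $x_{0},x_{2},\dots\in W$ (all even-indexed nodes) and $x_{1},x_{3},\dots\in N_{\mathcal{C}}(W)$ (all odd-indexed nodes).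
   Context: Graphs are simple (no loops, no multiple edges) and undirected; $x\sim y$ means $(x,y)\in E$. A set of nodes is independent if it contains no two adjacent nodes. $\Delta(V)=\{p\in\mathbb{R}^V : p_x\ge 0 \text{ for all } x\in V,\ \sum_{x\in V}p_x=1\}$ is the set of probability distributions on $V$. A point $x\in V$ is a mode of $p\in\Delta(V)$ if $p_x\ge p_y$ for all $y\sim x$. The polytope of $\mathcal{C}$-modes in $G$ is $\mathbf{M}(G,\mathcal{C})=\{p\in\Delta(V): \text{every } x\in\mathcal{C}\text{ is a mode of } p\}$. For non-empty $W\subseteq V\setminus\mathcal{C}$, $N_{\mathcal{C}}(W)=\{y\in\mathcal{C}: y\sim x\text{ for some }x\in W\}$, and $e_{\mathcal{C}}^{W}\in\Delta(V)$ is the uniform distribution on $N_{\mathcal{C}}(W)\cup W$. $\delta_x$ is the point distribution concentrated on $x$. *)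

theory Defs
  imports "HOL-Analysis.Analysis"
begin

text \<open>
  A finite simple graph on a non-empty node set is given by a finite type \<open>'v\<close> of nodes
  (types are non-empty) and a symmetric, irreflexive relation \<open>E\<close> with
  \<open>(x, y) \<in> E\<close> meaning that \<open>x\<close> and \<open>y\<close> are adjacent.
\<close>

definition simple_graph :: "('v \<times> 'v) set \<Rightarrow> bool" where
  "simple_graph E \<longleftrightarrow> sym E \<and> irrefl E"

definition independent_nodes :: "('v \<times> 'v) set \<Rightarrow> 'v set \<Rightarrow> bool" where
  "independent_nodes E C \<longleftrightarrow> (\<forall>x\<in>C. \<forall>y\<in>C. (x, y) \<notin> E)"

text \<open>The nodes of a path are pairwise distinct.\<close>

definition graph_path :: "('v \<times> 'v) set \<Rightarrow> 'v list \<Rightarrow> 'v \<Rightarrow> 'v \<Rightarrow> bool" where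
  "graph_path E xs x y \<longleftrightarrow>
     xs \<noteq> [] \<and> hd xs = x \<and> last xs = y \<and> distinct xs \<and>
     (\<forall>i. Suc i < length xs \<longrightarrow> (xs ! i, xs ! Suc i) \<in> E)"

definition prob_dists :: "(real ^ 'v::finite) set" where
  "prob_dists = {p. (\<forall>x. p $ x \<ge> 0) \<and> (\<Sum>x\<in>UNIV. p $ x) = 1}"

definition is_mode :: "('v \<times> 'v) set \<Rightarrow> real ^ 'v::finite \<Rightarrow> 'v \<Rightarrow> bool" where
  "is_mode E p x \<longleftrightarrow> (\<forall>y. (x, y) \<in> E \<longrightarrow> p $ x \<ge> p $ y)"

definition mode_polytope :: "('v \<times> 'v) set \<Rightarrow> 'v set \<Rightarrow> (real ^ 'v::finite) set" where
  "mode_polytope E C = {p \<in> prob_dists. \<forall>x\<in>C. is_mode E p x}"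

definition nbrs_in :: "('v \<times> 'v) set \<Rightarrow> 'v set \<Rightarrow> 'v set \<Rightarrow> 'v set" where
  "nbrs_in E C W = {y \<in> C. \<exists>x\<in>W. (y, x) \<in> E}"

definition uniform_dist :: "'v set \<Rightarrow> real ^ 'v::finite" where
  "uniform_dist S = (\<chi> x. if x \<in> S then 1 / real (card S) else 0)"

definition mode_point :: "('v \<times> 'v) set \<Rightarrow> 'v set \<Rightarrow> 'v set \<Rightarrow> real ^ 'v::finite" where
  "mode_point E C W = uniform_dist (nbrs_in E C W \<union> W)"

definition point_dist :: "'v \<Rightarrow> real ^ 'v::finite" where
  "point_dist x = (\<chi> y. if y = x then 1 else 0)"

end

theory Submission
  imports Defs
begin

text \<open>
  Let \<open>p\<close> satisfy all the mode inequalities and let \<open>W\<close> be the part of its support outside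
  \<open>C\<close>. Subtracting the minimum of \<open>p\<close> on \<open>W\<close> from all coordinates in
  \<open>N\<^sub>C(W) \<union> W\<close> preserves nonnegativity and the mode inequalities, and shrinks the support.
  Iterating this writes \<open>p\<close> as a nonnegative combination of the proposed generators.

  If \<open>e\<^sub>C\<^sup>W\<close> is a proper convex combination of \<open>a\<close> and \<open>b\<close>, then the mode inequalities of
  \<open>a\<close> along the edges between \<open>W\<close> and \<open>N\<^sub>C(W)\<close> are tight, so that \<open>a\<close> is constant on
  the connected components of the bipartite graph between \<open>W\<close> and \<open>N\<^sub>C(W)\<close>. With one component
  this forces \<open>a\<close> to be uniform; with several, \<open>e\<^sub>C\<^sup>W\<close> is a mixture of the uniform
  distributions on one component and on the union of the others.
\<close>

section \<open>Uniform distributions and convex combinations\<close>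

lemma sum_UNIV_eq_sum_subset:
  fixes f :: "'v::finite \<Rightarrow> real"
  assumes "\<And>x. x \<notin> S \<Longrightarrow> f x = 0"
  shows "sum f UNIV = sum f S"
  using assms by (intro sum.mono_neutral_right) auto

lemma uniform_dist_nth: "uniform_dist S $ x = (if x \<in> S then 1 / real (card S) else 0)"
  by (simp add: uniform_dist_def)

lemma uniform_dist_in_prob_dists:
  fixes S :: "'v::finite set"
  assumes "S \<noteq> {}"
  shows "uniform_dist S \<in> prob_dists"
proof -
  have "(\<Sum>x\<in>UNIV. uniform_dist S $ x) = (\<Sum>x\<in>S. uniform_dist S $ x)"
    by (rule sum_UNIV_eq_sum_subset) (simp add: uniform_dist_nth)
  also have "\<dots> = 1"
    using assms by (simp add: uniform_dist_nth)
  finally show ?thesis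
    by (simp add: prob_dists_def uniform_dist_nth)
qed

lemma point_dist_eq_uniform_dist: "point_dist x = uniform_dist {x}"
  by (simp add: vec_eq_iff point_dist_def uniform_dist_def)

lemma eq_uniform_distI:
  fixes p :: "real ^ 'v::finite"
  assumes p: "p \<in> prob_dists" and supp: "\<And>x. x \<notin> S \<Longrightarrow> p $ x = 0"
    and const: "\<And>x y. x \<in> S \<Longrightarrow> y \<in> S \<Longrightarrow> p $ x = p $ y"
  shows "p = uniform_dist S"
proof -
  have sum1: "(\<Sum>x\<in>S. p $ x) = 1"
    using p sum_UNIV_eq_sum_subset[of S "\<lambda>x. p $ x"] supp by (simp add: prob_dists_def)
  have "p $ y = 1 / real (card S)" if "y \<in> S" for y
  proof -
    have "(\<Sum>x\<in>S. p $ x) = (\<Sum>x\<in>S. p $ y)"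
      by (intro sum.cong refl const that)
    moreover have "card S \<noteq> 0"
      using that by auto
    ultimately show ?thesis
      using sum1 by (simp add: field_simps)
  qed
  then show ?thesis
    using supp by (simp add: vec_eq_iff uniform_dist_nth)
qed

text \<open>The mixture weights are the proportions of the two sets in their union. A point of
  \<open>A\<close> lies outside \<open>B\<close>, so the endpoints differ and the open segment is
  non-degenerate.\<close>

lemma uniform_dist_Un_disjoint:
  fixes A B :: "'v::finite set"
  assumes "A \<inter> B = {}" "A \<noteq> {}" "B \<noteq> {}"
  shows "uniform_dist (A \<union> B) \<in> open_segment (uniform_dist A) (uniform_dist B)"
proof -
  \<comment> \<open>The share of \<open>B\<close> in the union: scaling by \<open>u\<close> turns
    the height \<open>1 / card B\<close> into \<open>1 / card (A \<union> B)\<close>, and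
    \<open>1 - u\<close> does the same for \<open>A\<close>.\<close>
  define u where "u = real (card B) / real (card (A \<union> B))"
  have card: "real (card (A \<union> B)) = real (card A) + real (card B)"
    using assms by (simp add: card_Un_disjoint)
  have pos: "0 < real (card A)" "0 < real (card B)"
    using assms by (simp_all add: card_gt_0_iff)
  have u: "0 < u" "u < 1"
    using pos card by (simp_all add: u_def)
  have u': "u / real (card B) = 1 / real (card (A \<union> B))"
    "(1 - u) / real (card A) = 1 / real (card (A \<union> B))"
    using pos by (simp_all add: u_def card divide_simps assms del: of_nat_0_less_iff)
  obtain x where x: "x \<in> A" "x \<notin> B"
    using assms by blast
  have "uniform_dist A $ x \<noteq> uniform_dist B $ x"
    using x assms by (simp add: uniform_dist_nth)
  then have ne: "uniform_dist A \<noteq> uniform_dist B"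
    by auto
  have "uniform_dist (A \<union> B) = (1 - u) *\<^sub>R uniform_dist A + u *\<^sub>R uniform_dist B"
  proof (unfold vec_eq_iff, intro allI)
    fix y
    show "uniform_dist (A \<union> B) $ y = ((1 - u) *\<^sub>R uniform_dist A + u *\<^sub>R uniform_dist B) $ y"
      using assms(1) u' by (cases "y \<in> A"; cases "y \<in> B") (auto simp: uniform_dist_nth)
  qed
  then show ?thesis
    using ne u unfolding in_segment(2) by blast
qed

lemma convex_comb_nonneg_eq_0:
  fixes a b u :: real
  assumes "0 < u" "u < 1" "0 \<le> a" "0 \<le> b" "(1 - u) * a + u * b = 0"
  shows "a = 0"
proof -
  have "(1 - u) * a = 0"
    using assms by (smt (verit) mult_nonneg_nonneg)
  then show ?thesis
    using assms by simp
qed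

text \<open>Recovering a single endpoint suffices: an open segment omits its endpoints, so
  \<open>a = x\<close> already contradicts \<open>x\<close> lying inside it.\<close>

lemma extreme_point_ofI:
  assumes "x \<in> S"
    and "\<And>a b u. \<lbrakk>a \<in> S; b \<in> S; 0 < u; u < 1; x = (1 - u) *\<^sub>R a + u *\<^sub>R b\<rbrakk> \<Longrightarrow> a = x"
  shows "x extreme_point_of S"
  unfolding extreme_point_of_def
proof (intro conjI ballI notI)
  fix a b assume "a \<in> S" "b \<in> S" and seg: "x \<in> open_segment a b"
  then have "a = x"
    using assms(2) unfolding in_segment(2) by blast
  then show False
    using seg by (simp add: open_segment_def)
qed (rule assms(1))

section \<open>The cone of nonnegative vectors with prescribed modes\<close>

text \<open>The normalisation is dropped so that the set can be closed under subtracting suitable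
  multiples of generators.\<close>

definition mode_cone :: "('v \<times> 'v) set \<Rightarrow> 'v set \<Rightarrow> (real ^ 'v::finite) set" where
  "mode_cone E C = {p. (\<forall>x. 0 \<le> p $ x) \<and> (\<forall>x\<in>C. is_mode E p x)}"

lemma mode_polytope_eq: "mode_polytope E C = mode_cone E C \<inter> {p. (\<Sum>x\<in>UNIV. p $ x) = 1}"
  by (auto simp: mode_polytope_def mode_cone_def prob_dists_def)

lemma mode_polytope_nonneg: "p \<in> mode_polytope E C \<Longrightarrow> 0 \<le> p $ x"
  by (simp add: mode_polytope_def prob_dists_def)

lemma mode_polytope_le:
  "p \<in> mode_polytope E C \<Longrightarrow> x \<in> C \<Longrightarrow> (x, y) \<in> E \<Longrightarrow> p $ y \<le> p $ x"
  by (simp add: mode_polytope_def is_mode_def)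

lemma convex_mode_polytope: "convex (mode_polytope E C)"
proof (rule convexI)
  fix p q :: "real ^ 'a" and u v :: real
  assume p: "p \<in> mode_polytope E C" and q: "q \<in> mode_polytope E C"
    and uv: "0 \<le> u" "0 \<le> v" "u + v = 1"
  have "(\<Sum>x\<in>UNIV. (u *\<^sub>R p + v *\<^sub>R q) $ x) = u * (\<Sum>x\<in>UNIV. p $ x) + v * (\<Sum>x\<in>UNIV. q $ x)"
    by (simp add: sum.distrib sum_distrib_left)
  then have "(\<Sum>x\<in>UNIV. (u *\<^sub>R p + v *\<^sub>R q) $ x) = 1"
    using p q uv by (simp add: mode_polytope_def prob_dists_def)
  moreover have "u *\<^sub>R p + v *\<^sub>R q \<in> mode_cone E C"
    using p q uv
    by (auto simp: mode_polytope_eq mode_cone_def is_mode_def intro!: add_nonneg_nonneg add_mono mult_left_mono)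
  ultimately show "u *\<^sub>R p + v *\<^sub>R q \<in> mode_polytope E C"
    by (simp add: mode_polytope_eq)
qed

text \<open>With only the values \<open>0\<close> and \<open>1 / card A\<close>, a mode inequality
  at \<open>x\<close> could fail only for a neighbour \<open>y\<close> in \<open>A\<close> with
  \<open>x\<close> outside \<open>A\<close>. The second hypothesis excludes this.\<close>

lemma uniform_dist_in_mode_polytope:
  assumes "A \<noteq> {}" "\<And>x y. x \<in> C \<Longrightarrow> y \<in> A \<Longrightarrow> (x, y) \<in> E \<Longrightarrow> x \<in> A"
  shows "uniform_dist A \<in> mode_polytope E C"
  using assms uniform_dist_in_prob_dists[of A]
  by (auto simp: mode_polytope_def is_mode_def uniform_dist_nth)

lemma mode_point_in_mode_polytope:
  assumes "independent_nodes E C" "W \<noteq> {}"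
  shows "mode_point E C W \<in> mode_polytope E C"
  unfolding mode_point_def
  using assms by (intro uniform_dist_in_mode_polytope) (auto simp: independent_nodes_def nbrs_in_def)

lemma point_dist_in_mode_polytope:
  assumes "independent_nodes E C" "x \<in> C"
  shows "point_dist x \<in> mode_polytope E C"
  unfolding point_dist_eq_uniform_dist
  using assms by (intro uniform_dist_in_mode_polytope) (auto simp: independent_nodes_def)

abbreviation (input) mode_generators :: "('v \<times> 'v) set \<Rightarrow> 'v set \<Rightarrow> (real ^ 'v::finite) set" where
  "mode_generators E C \<equiv>
     {mode_point E C W | W. W \<noteq> {} \<and> W \<subseteq> UNIV - C} \<union> {point_dist x | x. x \<in> C}"

text \<open>One peeling step for the decomposition. The coordinate at \<open>z\<close> drops to
  zero, while every point of \<open>A\<close> was already in the support because \<open>c\<close> is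
  positive, so the support strictly shrinks.\<close>

lemma mode_cone_subtract_generator:
  fixes p :: "real ^ 'v::finite"
  assumes ind: "independent_nodes E C" and p: "p \<in> mode_cone E C" and nz: "p \<noteq> 0"
  obtains A z and c :: real where "uniform_dist A \<in> mode_generators E C" "0 < c" "z \<in> A" "p $ z = c"
    "\<And>x. x \<in> A \<Longrightarrow> c \<le> p $ x"
    "p - (c * card A) *\<^sub>R uniform_dist A \<in> mode_cone E C"
proof -
  define W where "W = {x. x \<notin> C \<and> p $ x \<noteq> 0}"
  have p0: "0 \<le> p $ x" for x
    using p by (simp add: mode_cone_def)
  have pm: "p $ y \<le> p $ x" if "x \<in> C" "(x, y) \<in> E" for x y
    using p that by (simp add: mode_cone_def is_mode_def)
  \<comment> \<open>The factor \<open>card A\<close> cancels the normalisation, so exactly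
    \<open>c\<close> is removed at each point of \<open>A\<close>.\<close>
  have q: "p - (c * card A) *\<^sub>R uniform_dist A = (\<chi> x. p $ x - (if x \<in> A then c else 0))" for c :: real and A
    by (auto simp: vec_eq_iff uniform_dist_nth)
  show thesis
  proof (cases "W = {}")
    case False
    define c where "c = Min (($) p ` W)"
    have "c \<in> ($) p ` W"
      unfolding c_def using False by (intro Min_in) auto
    then obtain z where z: "z \<in> W" "p $ z = c"
      by auto
    have c_le: "c \<le> p $ x" if "x \<in> W" for x
      unfolding c_def using that by simp
    \<comment> \<open>A node of \<open>nbrs_in E C W\<close> is a mode adjacent to some node of
      \<open>W\<close>, hence the minimum over \<open>W\<close> also bounds \<open>p\<close>
      there.\<close>
    have c_le': "c \<le> p $ x" if "x \<in> nbrs_in E C W \<union> W" for x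
    proof (cases "x \<in> W")
      case False
      with that obtain w where "w \<in> W" "(x, w) \<in> E" "x \<in> C"
        by (auto simp: nbrs_in_def)
      then show ?thesis
        using c_le[of w] pm[of x w] by linarith
    qed (rule c_le)
    have c0: "0 < c"
      using z p0[of z] by (auto simp: W_def)
    show thesis
    proof (rule that[of "nbrs_in E C W \<union> W" c z])
      show "uniform_dist (nbrs_in E C W \<union> W) \<in> mode_generators E C"
        using False unfolding mode_point_def W_def by blast
      have "p $ y - (if y \<in> nbrs_in E C W \<union> W then c else 0)
          \<le> p $ x - (if x \<in> nbrs_in E C W \<union> W then c else 0)" if xy: "x \<in> C" "(x, y) \<in> E" for x y
      proof (cases "y \<in> W")
        case True
        then have "x \<in> nbrs_in E C W"
          using xy by (auto simp: nbrs_in_def)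
        then show ?thesis
          using True pm[OF xy] by simp
      next
        case nW: False
        \<comment> \<open>Independence places \<open>y\<close> outside \<open>C\<close>, so
          \<open>p\<close> vanishes at \<open>y\<close> and nothing is subtracted there. The
          inequality reduces to nonnegativity at \<open>x\<close> after subtraction.\<close>
        have "y \<notin> C"
          using ind xy by (auto simp: independent_nodes_def)
        then have "p $ y = 0" "y \<notin> nbrs_in E C W \<union> W"
          using nW by (auto simp: W_def nbrs_in_def)
        then show ?thesis
          using c_le'[of x] p0[of x] by simp
      qed
      then show "p - (c * card (nbrs_in E C W \<union> W)) *\<^sub>R uniform_dist (nbrs_in E C W \<union> W)
          \<in> mode_cone E C"
        unfolding q using c_le' p0 by (simp add: mode_cone_def is_mode_def)
    qed (use z c0 c_le' in auto)
  next
    case True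
    \<comment> \<open>Here \<open>p\<close> is supported on \<open>C\<close>. Neighbours of
      \<open>C\<close> carry no mass, so the whole mass at one node can be removed as a multiple of
      a point distribution.\<close>
    obtain z where z: "p $ z \<noteq> 0"
      using nz by (auto simp: vec_eq_iff)
    then have zC: "z \<in> C"
      using True by (auto simp: W_def)
    show thesis
    proof (rule that[of "{z}" "p $ z" z])
      show "uniform_dist {z} \<in> mode_generators E C"
        using zC by (auto simp flip: point_dist_eq_uniform_dist)
      show "0 < p $ z"
        using z p0[of z] by simp
      have "p $ y = 0" if "x \<in> C" "(x, y) \<in> E" for x y
        using that True ind by (auto simp: W_def independent_nodes_def)
      then have "p $ y - (if y \<in> {z} then p $ z else 0) \<le> p $ x - (if x \<in> {z} then p $ z else 0)"
        if "x \<in> C" "(x, y) \<in> E" for x y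
        using that p0[of x] p0[of z] by auto
      then show "p - (p $ z * card {z}) *\<^sub>R uniform_dist {z} \<in> mode_cone E C"
        unfolding q using p0 by (simp add: mode_cone_def is_mode_def)
    qed auto
  qed
qed

text \<open>Strong induction on the size of the support. Keeping the total mass as an explicit
  factor lets the convex combination be rebuilt from a remainder of arbitrary mass.\<close>

lemma mode_cone_decomposition:
  fixes p :: "real ^ 'v::finite"
  assumes ind: "independent_nodes E C" and "p \<in> mode_cone E C" "p \<noteq> 0"
  shows "\<exists>h \<in> convex hull mode_generators E C. p = (\<Sum>x\<in>UNIV. p $ x) *\<^sub>R h"
  using assms(2-)
proof (induction "card {x. p $ x \<noteq> 0}" arbitrary: p rule: less_induct)
  case less
  let ?H = "convex hull mode_generators E C"
  obtain A z and c :: real where A: "uniform_dist A \<in> mode_generators E C" "0 < c" "z \<in> A" "p $ z = c"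
    and cA: "\<And>x. x \<in> A \<Longrightarrow> c \<le> p $ x"
    and q_cone: "p - (c * card A) *\<^sub>R uniform_dist A \<in> mode_cone E C"
    by (rule mode_cone_subtract_generator[OF ind less.prems]) (rule that)
  define m where "m = c * card A"
  define q where "q = p - m *\<^sub>R uniform_dist A"
  have q_nth: "q $ x = p $ x - (if x \<in> A then c else 0)" for x
    by (auto simp: q_def m_def uniform_dist_nth)
  have q: "q \<in> mode_cone E C" and pq: "p = m *\<^sub>R uniform_dist A + q"
    using q_cone by (simp_all add: q_def m_def)
  have AH: "uniform_dist A \<in> ?H"
    using A(1) by (rule hull_inc)
  have m: "0 < m"
    using A(2,3) by (auto simp: m_def card_gt_0_iff intro!: mult_pos_pos)
  have "p $ x \<noteq> 0" if "q $ x \<noteq> 0" for x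
    using that A(2) cA[of x] by (auto simp: q_nth split: if_splits)
  moreover have "p $ z \<noteq> 0" "q $ z = 0"
    using A by (simp_all add: q_nth)
  ultimately have "{x. q $ x \<noteq> 0} \<subset> {x. p $ x \<noteq> 0}"
    by blast
  then have smaller: "card {x. q $ x \<noteq> 0} < card {x. p $ x \<noteq> 0}"
    by (intro psubset_card_mono) auto
  define s where "s = (\<Sum>x\<in>UNIV. q $ x)"
  have "(\<Sum>x\<in>UNIV. uniform_dist A $ x) = 1"
    using uniform_dist_in_prob_dists[of A] A(3) by (auto simp: prob_dists_def)
  then have sum_p: "(\<Sum>x\<in>UNIV. p $ x) = m + s"
    unfolding pq s_def by (simp add: sum.distrib flip: sum_distrib_left)
  have s: "0 \<le> s"
    unfolding s_def using q by (intro sum_nonneg) (simp add: mode_cone_def)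
  show ?case
  \<comment> \<open>A zero remainder ends the peeling; the induction hypothesis speaks of nonzero
    vectors only.\<close>
  proof (cases "q = 0")
    case True
    then have "p = (\<Sum>x\<in>UNIV. p $ x) *\<^sub>R uniform_dist A"
      unfolding sum_p using pq by (simp add: s_def)
    then show ?thesis
      using AH by blast
  next
    case False
    obtain h where h: "h \<in> ?H" "q = s *\<^sub>R h"
      using less.hyps[OF smaller q False] unfolding s_def by blast
    \<comment> \<open>The removed generator and the normalised remainder are weighted by their
      masses \<open>m\<close> and \<open>s\<close>.\<close>
    let ?g = "(m / (m + s)) *\<^sub>R uniform_dist A + (s / (m + s)) *\<^sub>R h"
    have "?g \<in> ?H"
      using m s AH h(1) by (intro convexD[OF convex_convex_hull]) (auto simp flip: add_divide_distrib)
    moreover have "p = (m + s) *\<^sub>R ?g"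
      using m s h(2) pq by (simp add: scaleR_add_right)
    ultimately show ?thesis
      unfolding sum_p by blast
  qed
qed

lemma mode_polytope_eq_hull:
  fixes C :: "'v::finite set"
  assumes ind: "independent_nodes E C"
  shows "mode_polytope E C = convex hull mode_generators E C"
proof
  show "mode_polytope E C \<subseteq> convex hull mode_generators E C"
  proof
    fix p assume "p \<in> mode_polytope E C"
    then have p: "p \<in> mode_cone E C" and s: "(\<Sum>x\<in>UNIV. p $ x) = 1"
      by (simp_all add: mode_polytope_eq)
    have "p \<noteq> 0"
    proof
      assume "p = 0"
      then show False
        using s by simp
    qed
    then obtain h where "h \<in> convex hull mode_generators E C" "p = (\<Sum>x\<in>UNIV. p $ x) *\<^sub>R h"
      using mode_cone_decomposition[OF ind p] by blast
    then show "p \<in> convex hull mode_generators E C"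
      unfolding s scaleR_one by simp
  qed
  have "mode_generators E C \<subseteq> mode_polytope E C"
    using mode_point_in_mode_polytope[OF ind] point_dist_in_mode_polytope[OF ind] by blast
  then show "convex hull mode_generators E C \<subseteq> mode_polytope E C"
    by (rule hull_minimal) (rule convex_mode_polytope)
qed

section \<open>Vertices\<close>

text \<open>Outside \<open>S\<close> two nonnegative numbers with positive weights sum to zero, so
  each is zero.\<close>

lemma mode_polytope_supp:
  assumes "a \<in> mode_polytope E C" "b \<in> mode_polytope E C" "0 < u" "u < 1"
    and "uniform_dist S = (1 - u) *\<^sub>R a + u *\<^sub>R b" "x \<notin> S"
  shows "a $ x = 0"
proof (rule convex_comb_nonneg_eq_0[OF assms(3,4)])
  show "(1 - u) * a $ x + u * b $ x = 0"
    using arg_cong[OF assms(5), of "\<lambda>v. v $ x"] assms(6) by (simp add: uniform_dist_nth)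
qed (use assms mode_polytope_nonneg in auto)

lemma point_dist_extreme:
  assumes "independent_nodes E C" "x \<in> C"
  shows "point_dist x extreme_point_of mode_polytope E C"
proof (rule extreme_point_ofI)
  fix a b u
  assume ab: "a \<in> mode_polytope E C" "b \<in> mode_polytope E C" "0 < u" "u < 1"
    and eq: "point_dist x = (1 - u) *\<^sub>R a + u *\<^sub>R b"
  show "a = point_dist x"
    unfolding point_dist_eq_uniform_dist
  proof (rule eq_uniform_distI)
    show "a \<in> prob_dists"
      using ab by (simp add: mode_polytope_def)
    show "a $ y = 0" if "y \<notin> {x}" for y
      using mode_polytope_supp[OF ab] eq that unfolding point_dist_eq_uniform_dist by blast
  qed auto
qed (rule point_dist_in_mode_polytope[OF assms])

text \<open>The slacks of \<open>a\<close> and \<open>b\<close> along the edge are nonnegative, and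
  their weighted sum is the slack of the uniform distribution, which is zero as both ends lie in
  \<open>S\<close>.\<close>

lemma mode_polytope_tight:
  assumes ab: "a \<in> mode_polytope E C" "b \<in> mode_polytope E C" "0 < u" "u < 1"
    and eq: "uniform_dist S = (1 - u) *\<^sub>R a + u *\<^sub>R b"
    and xy: "x \<in> S" "y \<in> S" "x \<in> C" "(x, y) \<in> E"
  shows "a $ x = a $ y"
proof -
  have "a $ x - a $ y = 0"
  proof (rule convex_comb_nonneg_eq_0[OF ab(3,4)])
    have "(1 - u) * a $ x + u * b $ x = (1 - u) * a $ y + u * b $ y"
      using arg_cong[OF eq, of "\<lambda>v. v $ x"] arg_cong[OF eq, of "\<lambda>v. v $ y"] xy
      by (simp add: uniform_dist_nth)
    then show "(1 - u) * (a $ x - a $ y) + u * (b $ x - b $ y) = 0"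
      by (simp add: algebra_simps)
  qed (use ab xy mode_polytope_le in auto)
  then show ?thesis by simp
qed

section \<open>Alternating paths as reachability in a bipartite graph\<close>

definition bip_edges :: "('v \<times> 'v) set \<Rightarrow> 'v set \<Rightarrow> 'v set \<Rightarrow> ('v \<times> 'v) set" where
  "bip_edges E C W = E \<inter> (W \<times> nbrs_in E C W \<union> nbrs_in E C W \<times> W)"

lemma sym_bip_edges: "sym E \<Longrightarrow> sym (bip_edges E C W)"
  by (auto simp: bip_edges_def sym_def)

text \<open>Paths must have distinct nodes, so the induction appends the next node only if it is
  new; otherwise the path is cut at its earlier occurrence.\<close>

lemma rtrancl_imp_graph_path:
  assumes "(x, y) \<in> R\<^sup>*"
  shows "\<exists>xs. graph_path R xs x y"
  using assms
proof (induction rule: rtrancl_induct)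
  case base
  have "graph_path R [x] x x"
    by (simp add: graph_path_def)
  then show ?case ..
next
  case (step y z)
  then obtain xs where xs: "xs \<noteq> []" "hd xs = x" "last xs = y" "distinct xs"
    "\<And>i. Suc i < length xs \<Longrightarrow> (xs ! i, xs ! Suc i) \<in> R"
    by (auto simp: graph_path_def)
  show ?case
  proof (cases "z \<in> set xs")
    case True
    then obtain k where k: "k < length xs" "xs ! k = z"
      by (auto simp: in_set_conv_nth)
    \<comment> \<open>The prefix has length \<open>Suc k\<close> so that it still includes position
      \<open>k\<close>, where \<open>z\<close> sits.\<close>
    have "last (take (Suc k) xs) = z"
      using k by (simp add: take_Suc_conv_app_nth)
    then have "graph_path R (take (Suc k) xs) x z"
      using xs k by (auto simp: graph_path_def hd_take)
    then show ?thesis ..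
  next
    case False
    have "((xs @ [z]) ! i, (xs @ [z]) ! Suc i) \<in> R" if "Suc i < length (xs @ [z])" for i
    proof (cases "Suc i < length xs")
      case True
      then show ?thesis
        using xs(5) by (simp add: nth_append)
    next
      case False
      then have i: "i = length xs - 1"
        using that by simp
      then have "xs ! i = y"
        using xs by (simp add: last_conv_nth)
      then show ?thesis
        using step.hyps xs(1) i by (auto simp: nth_append)
    qed
    then have "graph_path R (xs @ [z]) x z"
      using xs False by (auto simp: graph_path_def)
    then show ?thesis ..
  qed
qed

lemma graph_path_imp_rtrancl:
  assumes "graph_path R xs x y"
  shows "(x, y) \<in> R\<^sup>*"
proof -
  have "(x, xs ! i) \<in> R\<^sup>*" if "i < length xs" for i
    using that
  proof (induction i)
    case 0
    then show ?case
      using assms by (simp add: graph_path_def flip: hd_conv_nth)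
  next
    case (Suc i)
    then have "(xs ! i, xs ! Suc i) \<in> R" "(x, xs ! i) \<in> R\<^sup>*"
      using assms by (auto simp: graph_path_def)
    then show ?case
      by (rule rtrancl_into_rtrancl[rotated])
  qed
  from this[of "length xs - 1"] show ?thesis
    using assms by (auto simp: graph_path_def last_conv_nth)
qed

text \<open>The two sides of the bipartite graph are disjoint, so a path that starts in
  \<open>W\<close> has to alternate; conversely, consecutive nodes of an alternating path form a
  bipartite edge.\<close>

lemma alternating_path_iff:
  assumes "W \<subseteq> UNIV - C" "x \<in> W"
  shows "(\<exists>xs. graph_path E xs x y \<and>
      (\<forall>i<length xs. (even i \<longrightarrow> xs ! i \<in> W) \<and> (odd i \<longrightarrow> xs ! i \<in> nbrs_in E C W)))
    \<longleftrightarrow> (x, y) \<in> (bip_edges E C W)\<^sup>*"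
proof
  assume "\<exists>xs. graph_path E xs x y \<and>
      (\<forall>i<length xs. (even i \<longrightarrow> xs ! i \<in> W) \<and> (odd i \<longrightarrow> xs ! i \<in> nbrs_in E C W))"
  then obtain xs where xs: "graph_path E xs x y"
    "\<And>i. i < length xs \<Longrightarrow> even i \<Longrightarrow> xs ! i \<in> W"
    "\<And>i. i < length xs \<Longrightarrow> odd i \<Longrightarrow> xs ! i \<in> nbrs_in E C W"
    by blast
  have "(xs ! i, xs ! Suc i) \<in> bip_edges E C W" if "Suc i < length xs" for i
    using xs(1) xs(2)[of i] xs(2)[of "Suc i"] xs(3)[of i] xs(3)[of "Suc i"] that
    by (cases "even i") (auto simp: bip_edges_def graph_path_def)
  then have "graph_path (bip_edges E C W) xs x y"
    using xs(1) by (simp add: graph_path_def)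
  then show "(x, y) \<in> (bip_edges E C W)\<^sup>*"
    by (rule graph_path_imp_rtrancl)
next
  assume "(x, y) \<in> (bip_edges E C W)\<^sup>*"
  then obtain xs where xs: "graph_path (bip_edges E C W) xs x y"
    using rtrancl_imp_graph_path by metis
  have disj: "W \<inter> nbrs_in E C W = {}"
    using assms by (auto simp: nbrs_in_def)
  have "(even i \<longrightarrow> xs ! i \<in> W) \<and> (odd i \<longrightarrow> xs ! i \<in> nbrs_in E C W)" if "i < length xs" for i
    using that
  proof (induction i)
    case 0
    then show ?case
      using xs assms by (simp add: graph_path_def flip: hd_conv_nth)
  next
    case (Suc i)
    then have "(xs ! i, xs ! Suc i) \<in> bip_edges E C W"
      using xs by (simp add: graph_path_def)
    then show ?case
      using Suc disj by (auto simp: bip_edges_def)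
  qed
  moreover have "graph_path E xs x y"
    using xs by (auto simp: graph_path_def bip_edges_def)
  ultimately show "\<exists>xs. graph_path E xs x y \<and>
      (\<forall>i<length xs. (even i \<longrightarrow> xs ! i \<in> W) \<and> (odd i \<longrightarrow> xs ! i \<in> nbrs_in E C W))"
    by blast
qed

section \<open>Extremality and connectedness\<close>

lemma mode_point_extreme_if_connected:
  fixes C :: "'v::finite set"
  assumes sym: "sym E" and ind: "independent_nodes E C" and W: "W \<noteq> {}"
    and conn: "\<And>x y. x \<in> W \<Longrightarrow> y \<in> W \<Longrightarrow> (x, y) \<in> (bip_edges E C W)\<^sup>*"
  shows "mode_point E C W extreme_point_of mode_polytope E C"
proof (rule extreme_point_ofI)
  let ?S = "nbrs_in E C W \<union> W"
  fix a b u
  assume ab: "a \<in> mode_polytope E C" "b \<in> mode_polytope E C" "0 < u" "u < 1"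
    and "mode_point E C W = (1 - u) *\<^sub>R a + u *\<^sub>R b"
  then have eq: "uniform_dist ?S = (1 - u) *\<^sub>R a + u *\<^sub>R b"
    by (simp add: mode_point_def)
  have tight: "a $ x = a $ y" if "x \<in> nbrs_in E C W" "y \<in> W" "(x, y) \<in> E" for x y
    using mode_polytope_tight[OF ab eq] that by (auto simp: nbrs_in_def)
  \<comment> \<open>Tightness is known for edges leaving the \<open>C\<close> side; symmetry of
    \<open>E\<close> supplies the other orientation.\<close>
  have step: "a $ x = a $ y" if "(x, y) \<in> bip_edges E C W" for x y
    using that tight[of x y] tight[of y x] symD[OF sym, of x y] by (auto simp: bip_edges_def)
  have path: "a $ x = a $ y" if "(x, y) \<in> (bip_edges E C W)\<^sup>*" for x y
    using that by (induction rule: rtrancl_induct) (auto dest: step)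
  obtain w where w: "w \<in> W"
    using W by blast
  have const: "a $ x = a $ w" if "x \<in> ?S" for x
  proof (cases "x \<in> W")
    case True
    then show ?thesis
      using path conn w by blast
  next
    case False
    then have x: "x \<in> nbrs_in E C W"
      using that by simp
    \<comment> \<open>Every node of \<open>nbrs_in E C W\<close> has a neighbour in
      \<open>W\<close>, which reduces its value to one on \<open>W\<close>.\<close>
    then obtain z where "z \<in> W" "(x, z) \<in> E"
      by (auto simp: nbrs_in_def)
    then have "a $ x = a $ z" "a $ z = a $ w"
      using x w by (auto intro: tight path conn)
    then show ?thesis by simp
  qed
  show "a = mode_point E C W"
    unfolding mode_point_def
  proof (rule eq_uniform_distI)
    show "a \<in> prob_dists"
      using ab by (simp add: mode_polytope_def)
    show "a $ x = 0" if "x \<notin> ?S" for x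
      using mode_polytope_supp[OF ab eq that] .
    show "a $ x = a $ y" if "x \<in> ?S" "y \<in> ?S" for x y
      using const that by metis
  qed
qed (rule mode_point_in_mode_polytope[OF ind W])

lemma connected_if_mode_point_extreme:
  fixes C :: "'v::finite set"
  assumes sym: "sym E" and ind: "independent_nodes E C" and W: "W \<subseteq> UNIV - C"
    and ext: "mode_point E C W extreme_point_of mode_polytope E C"
    and xy: "x \<in> W" "y \<in> W"
  shows "(x, y) \<in> (bip_edges E C W)\<^sup>*"
proof (rule ccontr)
  assume not_conn: "(x, y) \<notin> (bip_edges E C W)\<^sup>*"
  let ?R = "(bip_edges E C W)\<^sup>*"
  \<comment> \<open>\<open>W1\<close> is the part of \<open>W\<close> in the component of
    \<open>x\<close>; \<open>W2\<close> contains \<open>y\<close>.\<close>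
  define W1 where "W1 = {z \<in> W. (x, z) \<in> ?R}"
  define W2 where "W2 = W - W1"
  have ne: "W1 \<noteq> {}" "W2 \<noteq> {}"
    using xy not_conn by (auto simp: W1_def W2_def)
  have WW: "W = W1 \<union> W2"
    by (auto simp: W1_def W2_def)
  have "nbrs_in E C W1 \<inter> nbrs_in E C W2 = {}"
  proof (rule ccontr)
    assume "nbrs_in E C W1 \<inter> nbrs_in E C W2 \<noteq> {}"
    \<comment> \<open>A common neighbour \<open>v\<close> would link \<open>z1\<close> to
      \<open>z2\<close> and put \<open>z2\<close> in the component of \<open>x\<close>.\<close>
    then obtain v z1 z2 where v: "v \<in> C" "z1 \<in> W1" "z2 \<in> W2" "(v, z1) \<in> E" "(v, z2) \<in> E"
      by (auto simp: nbrs_in_def)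
    then have "(z1, v) \<in> bip_edges E C W" "(v, z2) \<in> bip_edges E C W"
      using symD[OF sym] WW by (auto simp: bip_edges_def nbrs_in_def)
    then have "(x, z2) \<in> ?R"
      using v(2) by (auto simp: W1_def intro: rtrancl_into_rtrancl)
    then show False
      using v(3) by (auto simp: W1_def W2_def)
  qed
  then have disj: "(nbrs_in E C W1 \<union> W1) \<inter> (nbrs_in E C W2 \<union> W2) = {}"
    using W by (auto simp: W1_def W2_def nbrs_in_def)
  have "nbrs_in E C W \<union> W = (nbrs_in E C W1 \<union> W1) \<union> (nbrs_in E C W2 \<union> W2)"
    unfolding WW by (auto simp: nbrs_in_def)
  then have "mode_point E C W \<in> open_segment (mode_point E C W1) (mode_point E C W2)"
    unfolding mode_point_def using uniform_dist_Un_disjoint[OF disj] ne by simp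
  moreover have "mode_point E C W1 \<in> mode_polytope E C" "mode_point E C W2 \<in> mode_polytope E C"
    using mode_point_in_mode_polytope[OF ind] ne by blast+
  ultimately show False
    using ext by (auto simp: extreme_point_of_def)
qed

theorem proposition1:
  fixes E :: "('v::finite \<times> 'v) set" and C :: "'v set"
  assumes "simple_graph E" and "independent_nodes E C"
  shows "mode_polytope E C =
           convex hull ({mode_point E C W | W. W \<noteq> {} \<and> W \<subseteq> UNIV - C} \<union> {point_dist x | x. x \<in> C})
    \<and> (\<forall>x\<in>C. point_dist x extreme_point_of mode_polytope E C)
    \<and> (\<forall>W. W \<noteq> {} \<and> W \<subseteq> UNIV - C \<longrightarrow>
         (mode_point E C W extreme_point_of mode_polytope E C \<longleftrightarrow>
           (\<forall>x\<in>W. \<forall>y\<in>W. x \<noteq> y \<longrightarrow>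
             (\<exists>xs. graph_path E xs x y \<and>
               (\<forall>i<length xs. (even i \<longrightarrow> xs ! i \<in> W) \<and> (odd i \<longrightarrow> xs ! i \<in> nbrs_in E C W))))))"
proof (intro conjI ballI allI impI)
  have sym: "sym E"
    using assms(1) by (simp add: simple_graph_def)
  show "mode_polytope E C = convex hull mode_generators E C"
    by (rule mode_polytope_eq_hull[OF assms(2)])
  show "point_dist x extreme_point_of mode_polytope E C" if "x \<in> C" for x
    using point_dist_extreme[OF assms(2) that] .
  fix W assume "W \<noteq> {} \<and> W \<subseteq> UNIV - C"
  then have W: "W \<noteq> {}" "W \<subseteq> UNIV - C"
    by auto
  have "mode_point E C W extreme_point_of mode_polytope E C \<longleftrightarrow>
      (\<forall>x\<in>W. \<forall>y\<in>W. (x, y) \<in> (bip_edges E C W)\<^sup>*)" (is "?ext \<longleftrightarrow> ?conn")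
  proof
    assume ?ext
    then show ?conn
      using connected_if_mode_point_extreme[OF sym assms(2) W(2)] by simp
  next
    assume ?conn
    then show ?ext
      by (intro mode_point_extreme_if_connected[OF sym assms(2) W(1)]) simp
  qed
  \<comment> \<open>The diagonal adds nothing, by reflexivity of the closure.\<close>
  also have "\<dots> \<longleftrightarrow> (\<forall>x\<in>W. \<forall>y\<in>W. x \<noteq> y \<longrightarrow> (x, y) \<in> (bip_edges E C W)\<^sup>*)"
    by (metis rtrancl.rtrancl_refl)
  also have "\<dots> \<longleftrightarrow> (\<forall>x\<in>W. \<forall>y\<in>W. x \<noteq> y \<longrightarrow>
      (\<exists>xs. graph_path E xs x y \<and>
        (\<forall>i<length xs. (even i \<longrightarrow> xs ! i \<in> W) \<and> (odd i \<longrightarrow> xs ! i \<in> nbrs_in E C W))))"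
    by (intro ball_cong refl imp_cong alternating_path_iff[OF W(2), symmetric])
  finally show "mode_point E C W extreme_point_of mode_polytope E C \<longleftrightarrow>
      (\<forall>x\<in>W. \<forall>y\<in>W. x \<noteq> y \<longrightarrow>
        (\<exists>xs. graph_path E xs x y \<and>
          (\<forall>i<length xs. (even i \<longrightarrow> xs ! i \<in> W) \<and> (odd i \<longrightarrow> xs ! i \<in> nbrs_in E C W))))"
    .
qed

end
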